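(* Let $X$ be a complete metric space and let $T:X\to X$ be an invertible mapping (that is, $T$ is continuous and bijective with continuous inverse $T^{-1}$). If $T$ is reiteratively hypercyclic then so is $T^{-1}$.
   Context: For $A\subset\mathbb{N}_0=\{0,1,2,\ldots\}$ the upper Banach density is $$\overline{\mathrm{Bd}}\, A = \sup\Big\{\delta\geq 0 : \forall n\geq 0\;\exists N\geq n, m\geq 0 :\frac{1}{N+1}\mathrm{card}(A \cap [m,m+N])\geq \delta\Big\},$$ which equals $\inf_{N\geq 0} \sup_{m\geq 0}\frac{1}{N+1}\mathrm{card}(A \cap [m,m+N])$. A continuous mapping $S:X\to X$ on a topological space is called reiteratively hypercyclic if there exists a point $x\in X$ such that, for any non-empty open set $U$ in $X$, $\overline{\mathrm{Bd}}\,\{n\geq 0 : S^nx\in U\}>0$. *)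

theory Defs
  imports "HOL-Analysis.Analysis"
begin

text \<open>The set in the supremum contains \<open>0\<close> and is bounded above by \<open>1\<close>, so the real-valued
  \<^const>\<open>Sup\<close> is the actual supremum.\<close>

definition upper_Banach_density :: "nat set \<Rightarrow> real" where
  "upper_Banach_density A =
     Sup {\<delta>. \<delta> \<ge> 0 \<and>
       (\<forall>n. \<exists>N\<ge>n. \<exists>m. 1 / (real N + 1) * real (card (A \<inter> {m..m + N})) \<ge> \<delta>)}"

definition reiteratively_hypercyclic :: "('a::topological_space \<Rightarrow> 'a) \<Rightarrow> bool" where
  "reiteratively_hypercyclic S \<longleftrightarrow>
     continuous_on UNIV S \<and>
     (\<exists>x. \<forall>U. open U \<and> U \<noteq> {} \<longrightarrow> upper_Banach_density {n. (S ^^ n) x \<in> U} > 0)"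

end

theory Submission
  imports Defs
begin

text \<open>
  Call a point reiteratively hypercyclic for \<open>S\<close> if its \<open>S\<close>-orbit visits every non-empty open set
  along a set of times of positive upper Banach density.  Positive density of a set \<open>A\<close> means that,
  for some \<open>d > 0\<close>, there are arbitrarily long windows in which \<open>A\<close> has proportion at least \<open>d\<close>.
  The location of these windows is irrelevant, and this is why time can be reversed: if the
  forward orbit of \<open>x\<close> visits \<open>U\<close> with proportion \<open>d\<close> in a window, then each later point
  \<open>T\<^sup>p x\<close> has a backward orbit that sees the same visits, in the mirror image of that window.

  The mirror image only yields, for a given length, some points whose backward orbit has one good
  window of at least that length.  Baire's theorem turns this into one point with good windows of
  all lengths and for all \<open>U\<close>.  A good window is a condition on finitely many iterates, so the
  points that admit one form an open set (\<open>open_dense_window\<close>).  This set is dense because \<open>x\<close>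
  visits any given open set \<open>V\<close> at arbitrarily late times, so that \<open>T\<^sup>p x\<close> can be chosen in \<open>V\<close>
  after the window (\<open>dense_window_inv_funpow\<close>).  Countably many \<open>U\<close> suffice, namely balls of
  radius \<open>1/(i+1)\<close> centred on the dense orbit of \<open>x\<close>; each comes with its own proportion \<open>d\<close>,
  inherited from \<open>x\<close>.
\<close>

definition dense_window :: "real \<Rightarrow> nat \<Rightarrow> nat set \<Rightarrow> bool" where
  "dense_window d n A \<longleftrightarrow> (\<exists>N\<ge>n. \<exists>m. d * (real N + 1) \<le> real (card (A \<inter> {m..m + N})))"

lemma dense_window_mono:
  assumes "A \<subseteq> B" and "dense_window d n A"
  shows "dense_window d n B"
proof -
  obtain N m where "N \<ge> n" and le: "d * (real N + 1) \<le> real (card (A \<inter> {m..m + N}))"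
    using assms(2) by (auto simp: dense_window_def)
  moreover have "card (A \<inter> {m..m + N}) \<le> card (B \<inter> {m..m + N})"
    using assms(1) by (intro card_mono) auto
  ultimately show ?thesis
    unfolding dense_window_def by (meson of_nat_mono order_trans)
qed

lemma upper_Banach_density_pos_iff:
  "upper_Banach_density A > 0 \<longleftrightarrow> (\<exists>d>0. \<forall>n. dense_window d n A)"
proof -
  define D where
    "D = {d::real. d \<ge> 0 \<and>
      (\<forall>n. \<exists>N\<ge>n. \<exists>m. 1 / (real N + 1) * real (card (A \<inter> {m..m + N})) \<ge> d)}"
  have D_iff: "d \<in> D \<longleftrightarrow> d \<ge> 0 \<and> (\<forall>n. dense_window d n A)" for d
    by (auto simp: D_def dense_window_def pos_le_divide_eq)
  have "0 \<in> D"
    by (auto simp: D_def)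
  have "d \<le> 1" if "d \<in> D" for d
  proof -
    obtain N m where d: "d * (real N + 1) \<le> real (card (A \<inter> {m..m + N}))"
      using \<open>d \<in> D\<close> by (auto simp: D_iff dense_window_def)
    have "card (A \<inter> {m..m + N}) \<le> card {m..m + N}"
      by (intro card_mono) auto
    then have "real (card (A \<inter> {m..m + N})) \<le> real N + 1"
      by simp
    with d have "d * (real N + 1) \<le> 1 * (real N + 1)"
      unfolding mult_1 by (rule order_trans)
    then show "d \<le> 1"
      by (rule mult_right_le_imp_le) simp
  qed
  then have "bdd_above D"
    by (auto simp: bdd_above_def)
  then have "upper_Banach_density A > 0 \<longleftrightarrow> (\<exists>d\<in>D. d > 0)"
    unfolding upper_Banach_density_def D_def[symmetric]
    using \<open>0 \<in> D\<close> by (intro less_cSup_iff) auto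
  then show ?thesis
    unfolding Bex_def D_iff by (meson less_imp_le)
qed

lemma infinite_if_upper_Banach_density_pos:
  assumes "upper_Banach_density A > 0"
  shows "infinite A"
proof
  assume "finite A"
  obtain d where "d > 0" and d: "\<And>n. dense_window d n A"
    using assms by (auto simp: upper_Banach_density_pos_iff)
  obtain n where n: "real (card A) < real n * d"
    using reals_Archimedean3[OF \<open>d > 0\<close>] by blast
  obtain N m where "N \<ge> n" and N: "d * (real N + 1) \<le> real (card (A \<inter> {m..m + N}))"
    using d[of n] by (auto simp: dense_window_def)
  have "card (A \<inter> {m..m + N}) \<le> card A"
    using \<open>finite A\<close> by (intro card_mono) auto
  moreover have "real n * d \<le> d * (real N + 1)"
    using \<open>N \<ge> n\<close> \<open>d > 0\<close> by (simp add: mult.commute)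
  ultimately show False
    using n N by linarith
qed

text \<open>At least \<open>c\<close> of finitely many continuous images of \<open>y\<close> lie in \<open>U\<close> exactly if all those with
  index in some \<open>J\<close> of cardinality at least \<open>c\<close> do: a union of finite intersections of preimages.\<close>

lemma open_card_visits_ge:
  assumes "finite F" and "\<And>j. continuous_on UNIV (f j)" and "open U"
  shows "open {y. c \<le> real (card {j \<in> F. f j y \<in> U})}"
proof -
  have "{y. c \<le> real (card {j \<in> F. f j y \<in> U})} =
      (\<Union>J\<in>{J. J \<subseteq> F \<and> c \<le> real (card J)}. \<Inter>j\<in>J. f j -` U)" (is "?L = ?R")
  proof
    show "?L \<subseteq> ?R"
    proof
      fix y assume "y \<in> ?L"
      then show "y \<in> ?R"
        by (intro UN_I[of "{j \<in> F. f j y \<in> U}"]) simp_all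
    qed
    show "?R \<subseteq> ?L"
    proof
      fix y assume "y \<in> ?R"
      then obtain J where J: "J \<subseteq> F" "c \<le> real (card J)" "\<forall>j\<in>J. f j y \<in> U"
        by auto
      then have "card J \<le> card {j \<in> F. f j y \<in> U}"
        using \<open>finite F\<close> by (intro card_mono) auto
      then show "y \<in> ?L"
        using J(2) by simp
    qed
  qed
  moreover have "open ?R"
  proof (intro open_UN ballI open_INT)
    show "finite J" if "J \<in> {J. J \<subseteq> F \<and> c \<le> real (card J)}" for J
      using that \<open>finite F\<close> by (auto intro: finite_subset)
    show "open (f j -` U)" for j
      using assms(2,3) by (intro open_vimage)
  qed
  ultimately show ?thesis
    by simp
qed

lemma continuous_on_funpow:
  fixes S :: "'a::topological_space \<Rightarrow> 'a"
  assumes "continuous_on UNIV S"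
  shows "continuous_on UNIV (S ^^ n)"
proof (induction n)
  case (Suc n)
  then show ?case
    using continuous_on_compose2[OF assms, of UNIV "S ^^ n"] by (simp add: comp_def)
qed (simp add: id_def)

lemma open_dense_window:
  fixes S :: "'a::topological_space \<Rightarrow> 'a"
  assumes "continuous_on UNIV S" and "open U"
  shows "open {y. dense_window d n {i. (S ^^ i) y \<in> U}}"
proof -
  have "{y. dense_window d n {i. (S ^^ i) y \<in> U}} =
      (\<Union>N\<in>{n..}. \<Union>m. {y. d * (real N + 1) \<le> real (card {i \<in> {m..m + N}. (S ^^ i) y \<in> U})})"
    by (auto simp: dense_window_def Int_def conj_commute)
  moreover have "open {y. c \<le> real (card {i \<in> {m..m + N}. (S ^^ i) y \<in> U})}" for c m N
    using assms by (intro open_card_visits_ge continuous_on_funpow finite_atLeastAtMost)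
  ultimately show ?thesis
    by (simp add: open_UN)
qed

lemma inv_funpow_funpow:
  assumes "inj T" and "i \<le> p"
  shows "(inv T ^^ i) ((T ^^ p) x) = (T ^^ (p - i)) x"
  using \<open>i \<le> p\<close>
proof (induction i)
  case (Suc i)
  then have "(T ^^ (p - i)) x = T ((T ^^ (p - Suc i)) x)"
    by (metis Suc_diff_Suc Suc_le_lessD comp_apply funpow.simps(2))
  with Suc \<open>inj T\<close> show ?case
    by simp
qed simp

text \<open>The reflection \<open>j \<mapsto> p - j\<close> carries a window of forward visits of \<open>x\<close> that ends by time
  \<open>p\<close> injectively to a window, of the same length, of backward visits of \<open>T\<^sup>p x\<close>.  The infinite
  set of visits to \<open>V\<close> supplies such a \<open>p\<close>.\<close>

lemma dense_window_inv_funpow: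
  assumes "inj T"
    and "dense_window d n {j. (T ^^ j) x \<in> U}"
    and "infinite {p. (T ^^ p) x \<in> V}"
  shows "\<exists>y\<in>V. dense_window d n {i. (inv T ^^ i) y \<in> U}"
proof -
  obtain N m where "N \<ge> n"
    and visits: "d * (real N + 1) \<le> real (card ({j. (T ^^ j) x \<in> U} \<inter> {m..m + N}))"
    using assms(2) by (auto simp: dense_window_def)
  obtain p where p: "p \<ge> m + N" "(T ^^ p) x \<in> V"
    using assms(3) by (auto simp: infinite_nat_iff_unbounded_le)
  let ?A = "{j. (T ^^ j) x \<in> U} \<inter> {m..m + N}"
  let ?B = "{i. (inv T ^^ i) ((T ^^ p) x) \<in> U} \<inter> {p - (m + N)..p - (m + N) + N}"
  have "card ?A \<le> card ?B"
  proof (rule card_inj_on_le)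
    show "inj_on (\<lambda>j. p - j) ?A"
      using p(1) by (auto simp: inj_on_def)
    show "(\<lambda>j. p - j) ` ?A \<subseteq> ?B"
      using p(1) by (auto simp: inv_funpow_funpow[OF \<open>inj T\<close>])
  qed simp
  with visits have "d * (real N + 1) \<le> real (card ?B)"
    by linarith
  with \<open>N \<ge> n\<close> have "dense_window d n {i. (inv T ^^ i) ((T ^^ p) x) \<in> U}"
    unfolding dense_window_def by blast
  with p(2) show ?thesis
    by blast
qed

lemma ex_common_point_of_open_dense_sets:
  fixes \<G> :: "'a::complete_space set set"
  assumes "countable \<G>"
    and "\<And>G. G \<in> \<G> \<Longrightarrow> open G"
    and "\<And>G V. G \<in> \<G> \<Longrightarrow> open V \<Longrightarrow> V \<noteq> {} \<Longrightarrow> G \<inter> V \<noteq> {}"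
  shows "\<Inter>\<G> \<noteq> {}"
proof -
  have "closure G = UNIV" if "G \<in> \<G>" for G
  proof (rule ccontr)
    assume "closure G \<noteq> UNIV"
    then have "G \<inter> - closure G \<noteq> {}"
      using assms(3)[OF that, of "- closure G"] by auto
    then show False
      using closure_subset by blast
  qed
  then have "Met_TC.mtopology closure_of \<Inter>\<G> = UNIV"
    using assms(1,2) complete_UNIV
    by (intro Met_TC.metric_Baire_category) simp_all
  then have "closure (\<Inter>\<G>) = UNIV"
    by simp
  then show ?thesis
    by (metis UNIV_not_empty closure_empty)
qed

theorem theorem20:
  fixes T :: "'a::complete_space \<Rightarrow> 'a"
  assumes "bij T"
    and "continuous_on UNIV T"
    and "continuous_on UNIV (inv T)"
    and "reiteratively_hypercyclic T"
  shows "reiteratively_hypercyclic (inv T)"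
proof -
  obtain x where x: "\<And>U. open U \<Longrightarrow> U \<noteq> {} \<Longrightarrow> upper_Banach_density {n. (T ^^ n) x \<in> U} > 0"
    using assms(4) by (auto simp: reiteratively_hypercyclic_def)
  have "inj T"
    using \<open>bij T\<close> by (rule bij_is_inj)
  define B where "B = (\<lambda>k i. ball ((T ^^ k) x) (1 / real (Suc i)))"
  have B: "open (B k i)" "B k i \<noteq> {}" for k i
    by (auto simp: B_def)
  have "\<exists>d>0. \<forall>n. dense_window d n {j. (T ^^ j) x \<in> B k i}" for k i
    using x[OF B] by (simp add: upper_Banach_density_pos_iff)
  then obtain d where d_pos: "d k i > 0"
    and d: "\<forall>n. dense_window (d k i) n {j. (T ^^ j) x \<in> B k i}" for k i
    by metis
  define G where "G = (\<lambda>(k, i, n). {y. dense_window (d k i) n {j. (inv T ^^ j) y \<in> B k i}})"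
  have "\<Inter>(range G) \<noteq> {}"
  proof (rule ex_common_point_of_open_dense_sets)
    show "open H" if "H \<in> range G" for H
      using that assms(3) B by (auto simp: G_def intro!: open_dense_window)
    show "H \<inter> V \<noteq> {}" if "H \<in> range G" "open V" "V \<noteq> {}" for H V
    proof -
      have "infinite {p. (T ^^ p) x \<in> V}"
        using x[OF that(2,3)] by (rule infinite_if_upper_Banach_density_pos)
      then have "\<exists>y\<in>V. y \<in> G (k, i, n)" for k i n
        using dense_window_inv_funpow[OF \<open>inj T\<close> d[rule_format]] by (simp add: G_def)
      then show ?thesis
        using that(1) by auto
    qed
  qed auto
  then obtain y where "\<And>k i n. y \<in> G (k, i, n)"
    by blast
  then have y: "dense_window (d k i) n {j. (inv T ^^ j) y \<in> B k i}" for k i n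
    by (simp add: G_def)
  have "upper_Banach_density {j. (inv T ^^ j) y \<in> U} > 0" if "open U" "U \<noteq> {}" for U
  proof -
    have "{k. (T ^^ k) x \<in> U} \<noteq> {}"
      using infinite_if_upper_Banach_density_pos[OF x[OF that]] by (metis finite.emptyI)
    then obtain k where "(T ^^ k) x \<in> U"
      by blast
    then obtain e where "e > 0" and e: "ball ((T ^^ k) x) e \<subseteq> U"
      using \<open>open U\<close> open_contains_ball by blast
    obtain i where "1 / real (Suc i) < e"
      using \<open>e > 0\<close> nat_approx_posE by blast
    then have "B k i \<subseteq> U"
      using e subset_ball[of "1 / real (Suc i)" e "(T ^^ k) x"] by (auto simp: B_def)
    then have "dense_window (d k i) n {j. (inv T ^^ j) y \<in> U}" for n
      by (intro dense_window_mono[OF _ y[of k i n]]) (simp add: Collect_mono subset_iff)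
    then show ?thesis
      using d_pos by (auto simp: upper_Banach_density_pos_iff)
  qed
  then show ?thesis
    using assms(3) by (auto simp: reiteratively_hypercyclic_def)
qed

end
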